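(* For every $i \in \{1,2,3,4,5,6,7,8\}$, every set of formulas $\Gamma$ and every formula $A$, the translation $A \mapsto A^{\mathrm{K}_i}$ satisfies: 1. (soundness) if $\mathsf{CL} + \Gamma \vdash A$, then $\mathsf{ML} + \Gamma^{\mathrm{K}_i} \vdash A^{\mathrm{K}_i}$; 2. (characterisation) $\mathsf{CL} \vdash A \leftrightarrow A^{\mathrm{K}_i}$.
   Context: Formulas are those of first-order predicate logic, built from atomic formulas (including $\bot$) by $\wedge$, $\vee$, $\to$, $\forall$, $\exists$. Negation is the abbreviation $\neg A \equiv (A \to \bot)$, and $A \leftrightarrow B$ abbreviates $(A \to B) \wedge (B \to A)$. The connectives $\wedge$ and $\vee$ bind more strongly than $\to$. $\mathsf{CL}$ denotes classical predicate logic and $\mathsf{ML}$ denotes minimal predicate logic, that is, intuitionistic predicate logic without ex falso quodlibet $\bot \to A$ (so in $\mathsf{ML}$ the formula $\bot$ has no special rules). For a set $\Gamma$ of formulas, $\mathsf{L} + \Gamma \vdash A$ means that $A$ is derivable in the logic $\mathsf{L}$ from the formulas in $\Gamma$ as additional axioms, and $\Gamma^{\mathrm{K}_i} = \{B^{\mathrm{K}_i} : B \in \Gamma\}$. For each $i \in \{1,\dots,8\}$ the translation $\mathrm{K}_i$ maps each formula $A$ to $$A^{\mathrm{K}_i} \equiv \neg\neg A_{\mathrm{K}_i},$$ where $A_{\mathrm{K}_i}$ is defined by recursion on the length of $A$. The default clauses (those of the Kuroda negative translation), with $P$ ranging over atomic formulas (including $\bot$), are: - $P_{\mathrm{K}_i}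 \equiv P$, - $(A \wedge B)_{\mathrm{K}_i} \equiv A_{\mathrm{K}_i} \wedge B_{\mathrm{K}_i}$, - $(A \vee B)_{\mathrm{K}_i} \equiv A_{\mathrm{K}_i} \vee B_{\mathrm{K}_i}$, - $(A \to B)_{\mathrm{K}_i} \equiv A_{\mathrm{K}_i} \to B_{\mathrm{K}_i}$, - $(\forall x\, A)_{\mathrm{K}_i} \equiv \forall x\, \neg\neg A_{\mathrm{K}_i}$, - $(\exists x\, A)_{\mathrm{K}_i} \equiv \exists x\, A_{\mathrm{K}_i}$. For each $i$ exactly one of these clauses is replaced, as follows (all other clauses are the default ones): - $i=1$: $P_{\mathrm{K}_1} \equiv P \vee \bot$; - $i=2$: $P_{\mathrm{K}_2} \equiv \neg\neg P$; - $i=3$: $P_{\mathrm{K}_3} \equiv (\bot \to P) \to P$; - $i=4$: $(A \to B)_{\mathrm{K}_4} \equiv A_{\mathrm{K}_4} \to (B_{\mathrm{K}_4} \vee \bot)$; - $i=5$: $(A \to B)_{\mathrm{K}_5} \equiv \neg (A_{\mathrm{K}_5}) \vee B_{\mathrm{K}_5}$; - $i=6$: $(A \to B)_{\mathrm{K}_6} \equiv A_{\mathrm{K}_6} \to \neg\neg (B_{\mathrm{K}_6})$; - $i=7$: $(A \to B)_{\mathrm{K}_7} \equiv \neg (B_{\mathrm{K}_7}) \to \neg (A_{\mathrm{K}_7})$; - $i=8$: $(A \to B)_{\mathrm{K}_8} \equiv \neg(A_{\mathrm{K}_8} \wedge \neg (B_{\mathrm{K}_8}))$. *)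

theory Defs
  imports Main
begin

text \<open>
  First-order formulas in de Bruijn notation: \<open>Var n\<close> below \<open>k\<close> quantifiers is bound if \<open>n < k\<close>
  and is the free variable number \<open>n - k\<close> otherwise.
\<close>

datatype 'f tm = Var nat | Fun 'f "'f tm list"

datatype ('f, 'p) fm =
    Bot
  | Pred 'p "'f tm list"
  | And "('f, 'p) fm" "('f, 'p) fm"
  | Or "('f, 'p) fm" "('f, 'p) fm"
  | Imp "('f, 'p) fm" "('f, 'p) fm"
  | All "('f, 'p) fm"
  | Ex "('f, 'p) fm"

abbreviation Neg :: "('f, 'p) fm \<Rightarrow> ('f, 'p) fm" where
  "Neg A \<equiv> Imp A Bot"

abbreviation Iff :: "('f, 'p) fm \<Rightarrow> ('f, 'p) fm \<Rightarrow> ('f, 'p) fm" where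
  "Iff A B \<equiv> And (Imp A B) (Imp B A)"

text \<open>
  A signature lists the function symbols (constants have arity 0) and the predicate symbols,
  each paired with its arity. It may be empty, finite or infinite. The terms and formulas of
  the language are those satisfying \<open>wf_tm\<close> and \<open>wf_fm\<close>.
\<close>

type_synonym ('f, 'p) signature = "('f \<times> nat) set \<times> ('p \<times> nat) set"

primrec wf_tm :: "('f, 'p) signature \<Rightarrow> 'f tm \<Rightarrow> bool" where
  "wf_tm S (Var n) \<longleftrightarrow> True"
| "wf_tm S (Fun f ts) \<longleftrightarrow> (f, length ts) \<in> fst S \<and> list_all (wf_tm S) ts"

primrec wf_fm :: "('f, 'p) signature \<Rightarrow> ('f, 'p) fm \<Rightarrow> bool" where
  "wf_fm S Bot \<longleftrightarrow> True"
| "wf_fm S (Pred p ts) \<longleftrightarrow> (p, length ts) \<in> snd S \<and> list_all (wf_tm S) ts"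
| "wf_fm S (And A B) \<longleftrightarrow> wf_fm S A \<and> wf_fm S B"
| "wf_fm S (Or A B) \<longleftrightarrow> wf_fm S A \<and> wf_fm S B"
| "wf_fm S (Imp A B) \<longleftrightarrow> wf_fm S A \<and> wf_fm S B"
| "wf_fm S (All A) \<longleftrightarrow> wf_fm S A"
| "wf_fm S (Ex A) \<longleftrightarrow> wf_fm S A"

primrec subst_tm :: "(nat \<Rightarrow> 'f tm) \<Rightarrow> 'f tm \<Rightarrow> 'f tm" where
  "subst_tm s (Var n) = s n"
| "subst_tm s (Fun f ts) = Fun f (map (subst_tm s) ts)"

definition under :: "(nat \<Rightarrow> 'f tm) \<Rightarrow> nat \<Rightarrow> 'f tm" where
  "under s = case_nat (Var 0) (\<lambda>n. subst_tm (\<lambda>m. Var (Suc m)) (s n))"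

primrec subst_fm :: "(nat \<Rightarrow> 'f tm) \<Rightarrow> ('f, 'p) fm \<Rightarrow> ('f, 'p) fm" where
  "subst_fm s Bot = Bot"
| "subst_fm s (Pred p ts) = Pred p (map (subst_tm s) ts)"
| "subst_fm s (And A B) = And (subst_fm s A) (subst_fm s B)"
| "subst_fm s (Or A B) = Or (subst_fm s A) (subst_fm s B)"
| "subst_fm s (Imp A B) = Imp (subst_fm s A) (subst_fm s B)"
| "subst_fm s (All A) = All (subst_fm (under s) A)"
| "subst_fm s (Ex A) = Ex (subst_fm (under s) A)"

definition lift :: "('f, 'p) fm \<Rightarrow> ('f, 'p) fm" where
  "lift A = subst_fm (\<lambda>n. Var (Suc n)) A"

text \<open>\<open>inst t A\<close> is the body \<open>A\<close> of a quantified formula with \<open>t\<close> put for the bound variable.\<close>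

definition inst :: "'f tm \<Rightarrow> ('f, 'p) fm \<Rightarrow> ('f, 'p) fm" where
  "inst t A = subst_fm (case_nat t Var) A"

text \<open>
  Natural deduction. In \<open>derives S L G D A\<close>, the set \<open>G\<close> holds the additional axioms and
  \<open>D\<close> the open assumptions. The eigenvariable conditions of \<open>AllI\<close> and \<open>ExE\<close>, expressed by
  lifting, concern the open assumptions (and the conclusion of \<open>ExE\<close>) but not \<open>G\<close>: as usual
  for axioms, a formula in \<open>G\<close> has the same consequences as its universal closure.
  There is no rule for \<open>Bot\<close> in minimal logic; ex falso is derivable from \<open>DNE\<close> in
  classical logic.
  The well-formedness premises ensure that, if \<open>G\<close> and \<open>D\<close> consist of formulas over \<open>S\<close>,
  then so does the whole derivation.
\<close>

datatype logic = Minimal | Classical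

inductive derives ::
  "('f, 'p) signature \<Rightarrow> logic \<Rightarrow> ('f, 'p) fm set \<Rightarrow> ('f, 'p) fm set \<Rightarrow> ('f, 'p) fm \<Rightarrow> bool"
  for S :: "('f, 'p) signature" and L :: logic and G :: "('f, 'p) fm set"
where
  Axiom: "A \<in> G \<Longrightarrow> derives S L G D A"
| Assm: "A \<in> D \<Longrightarrow> derives S L G D A"
| AndI: "derives S L G D A \<Longrightarrow> derives S L G D B \<Longrightarrow> derives S L G D (And A B)"
| AndE1: "derives S L G D (And A B) \<Longrightarrow> derives S L G D A"
| AndE2: "derives S L G D (And A B) \<Longrightarrow> derives S L G D B"
| OrI1: "derives S L G D A \<Longrightarrow> wf_fm S B \<Longrightarrow> derives S L G D (Or A B)"
| OrI2: "derives S L G D B \<Longrightarrow> wf_fm S A \<Longrightarrow> derives S L G D (Or A B)"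
| OrE: "derives S L G D (Or A B) \<Longrightarrow> derives S L G (insert A D) C \<Longrightarrow>
    derives S L G (insert B D) C \<Longrightarrow> derives S L G D C"
| ImpI: "wf_fm S A \<Longrightarrow> derives S L G (insert A D) B \<Longrightarrow> derives S L G D (Imp A B)"
| ImpE: "derives S L G D (Imp A B) \<Longrightarrow> derives S L G D A \<Longrightarrow> derives S L G D B"
| AllI: "derives S L G (lift ` D) A \<Longrightarrow> derives S L G D (All A)"
| AllE: "derives S L G D (All A) \<Longrightarrow> wf_tm S t \<Longrightarrow> derives S L G D (inst t A)"
| ExI: "derives S L G D (inst t A) \<Longrightarrow> wf_tm S t \<Longrightarrow> derives S L G D (Ex A)"
| ExE: "derives S L G D (Ex A) \<Longrightarrow> derives S L G (insert A (lift ` D)) (lift C) \<Longrightarrow>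
    derives S L G D C"
| DNE: "L = Classical \<Longrightarrow> derives S L G D (Neg (Neg A)) \<Longrightarrow> derives S L G D A"

definition provable ::
  "('f, 'p) signature \<Rightarrow> logic \<Rightarrow> ('f, 'p) fm set \<Rightarrow> ('f, 'p) fm \<Rightarrow> bool" where
  "provable S L G A \<longleftrightarrow> derives S L G {} A"

text \<open>
  The variants of the Kuroda translation. Only the clauses for atoms and for implication
  depend on the index, which is meant to range over \<open>{1..8}\<close>; other indices give the
  default clauses.
\<close>

definition K_atom :: "nat \<Rightarrow> ('f, 'p) fm \<Rightarrow> ('f, 'p) fm" where
  "K_atom i P =
    (if i = 1 then Or P Bot
     else if i = 2 then Neg (Neg P)
     else if i = 3 then Imp (Imp Bot P) P
     else P)"

definition K_imp :: "nat \<Rightarrow> ('f, 'p) fm \<Rightarrow> ('f, 'p) fm \<Rightarrow> ('f, 'p) fm" where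
  "K_imp i A B =
    (if i = 4 then Imp A (Or B Bot)
     else if i = 5 then Or (Neg A) B
     else if i = 6 then Imp A (Neg (Neg B))
     else if i = 7 then Imp (Neg B) (Neg A)
     else if i = 8 then Neg (And A (Neg B))
     else Imp A B)"

primrec K_sub :: "nat \<Rightarrow> ('f, 'p) fm \<Rightarrow> ('f, 'p) fm" where
  "K_sub i Bot = K_atom i Bot"
| "K_sub i (Pred p ts) = K_atom i (Pred p ts)"
| "K_sub i (And A B) = And (K_sub i A) (K_sub i B)"
| "K_sub i (Or A B) = Or (K_sub i A) (K_sub i B)"
| "K_sub i (Imp A B) = K_imp i (K_sub i A) (K_sub i B)"
| "K_sub i (All A) = All (Neg (Neg (K_sub i A)))"
| "K_sub i (Ex A) = Ex (K_sub i A)"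

definition K_trans :: "nat \<Rightarrow> ('f, 'p) fm \<Rightarrow> ('f, 'p) fm" where
  "K_trans i A = Neg (Neg (K_sub i A))"

end

theory Submission
  imports Defs
begin

text \<open>
  In minimal logic \<open>\<not>\<not>\<close> is a monad, so every rule other than implication introduction and double
  negation elimination lifts to doubly negated formulas. All eight clauses for implication satisfy
  that \<open>\<not>\<not>(A \<rightarrow> B)\<^sub>K\<close> is equivalent to \<open>A\<^sub>K \<rightarrow> \<not>\<not>B\<^sub>K\<close> in minimal logic; for the variants 1, 2, 3 of the
  atomic clause this needs \<open>\<bottom> \<rightarrow> B\<^sub>K\<close>, which the modified atoms make provable by induction on \<open>B\<close>.
  This equivalence, together with \<open>\<bottom>\<^sub>K \<leftrightarrow> \<bottom>\<close>, handles the two remaining rules.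
\<close>

section \<open>Substitution and well-formedness\<close>

lemma wf_subst_tm: "wf_tm S t \<Longrightarrow> (\<And>n. wf_tm S (s n)) \<Longrightarrow> wf_tm S (subst_tm s t)"
  by (induction t) (auto simp: list_all_iff)

lemma wf_tm_if_wf_subst_tm: "wf_tm S (subst_tm s t) \<Longrightarrow> wf_tm S t"
  by (induction t) (auto simp: list_all_iff)

lemma wf_under: "(\<And>n. wf_tm S (s n)) \<Longrightarrow> wf_tm S (under s n)"
  by (auto simp: under_def wf_subst_tm split: nat.split)

lemma wf_subst_fm: "wf_fm S A \<Longrightarrow> (\<And>n. wf_tm S (s n)) \<Longrightarrow> wf_fm S (subst_fm s A)"
  by (induction A arbitrary: s) (auto simp: list_all_iff wf_subst_tm wf_under)

text \<open>A substitution keeps every function and predicate symbol of \<open>A\<close>, with its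
  arity. This matters for \<open>ExI\<close>, whose premise shows the quantified body only through
  an instance.\<close>

lemma wf_fm_if_wf_subst_fm: "wf_fm S (subst_fm s A) \<Longrightarrow> wf_fm S A"
  by (induction A arbitrary: s) (auto simp: list_all_iff dest: wf_tm_if_wf_subst_tm)

lemma wf_lift: "wf_fm S (lift A) \<longleftrightarrow> wf_fm S A"
  unfolding lift_def by (auto intro: wf_subst_fm dest: wf_fm_if_wf_subst_fm)

lemma wf_inst: "wf_fm S A \<Longrightarrow> wf_tm S t \<Longrightarrow> wf_fm S (inst t A)"
  unfolding inst_def by (rule wf_subst_fm) (auto split: nat.split)

lemma wf_fm_if_wf_inst: "wf_fm S (inst t A) \<Longrightarrow> wf_fm S A"
  unfolding inst_def by (rule wf_fm_if_wf_subst_fm)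

section \<open>Identity and renaming substitutions\<close>

lemma subst_tm_Var: "subst_tm Var t = t"
  by (induction t) (auto simp: map_idI)

lemma under_Var: "under Var = Var"
  by (auto simp: under_def fun_eq_iff split: nat.split)

lemma subst_fm_Var: "subst_fm Var A = A"
  by (induction A) (auto simp: subst_tm_Var under_Var map_idI)

lemma subst_tm_rename: "subst_tm s (subst_tm (\<lambda>n. Var (r n)) t) = subst_tm (\<lambda>n. s (r n)) t"
  by (induction t) auto

lemma under_rename: "under (\<lambda>n. Var (r n)) = (\<lambda>n. Var (case_nat 0 (\<lambda>m. Suc (r m)) n))"
  by (auto simp: under_def fun_eq_iff split: nat.split)

lemma under_comp_rename:
  "(\<lambda>n. under s (case_nat 0 (\<lambda>m. Suc (r m)) n)) = under (\<lambda>n. s (r n))"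
  by (auto simp: under_def fun_eq_iff split: nat.split)

lemma subst_fm_rename: "subst_fm s (subst_fm (\<lambda>n. Var (r n)) A) = subst_fm (\<lambda>n. s (r n)) A"
  by (induction A arbitrary: s r) (auto simp: subst_tm_rename under_rename under_comp_rename)

text \<open>Under the binder, lifting fixes index 0 and raises every other index by one;
  instantiating with \<open>Var 0\<close> fixes 0 and lowers the others again. So variable 0 serves
  as the eigenvariable when a lifted quantified formula is opened.\<close>

lemma inst_lift_body:
  fixes A :: "('f, 'p) fm"
  shows "inst (Var 0) (subst_fm (under (\<lambda>n. Var (Suc n))) A) = A"
proof -
  have "(\<lambda>n. case_nat (Var 0) Var (case_nat 0 (\<lambda>m. Suc (Suc m)) n)) = (Var :: nat \<Rightarrow> 'f tm)"
    by (auto simp: fun_eq_iff split: nat.split)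
  then show ?thesis
    unfolding inst_def under_rename subst_fm_rename by (simp only: subst_fm_Var)
qed

lemma lift_simps [simp]:
  "lift Bot = Bot"
  "lift (Imp A B) = Imp (lift A) (lift B)"
  "lift (All A) = All (subst_fm (under (\<lambda>n. Var (Suc n))) A)"
  "lift (Ex A) = Ex (subst_fm (under (\<lambda>n. Var (Suc n))) A)"
  by (simp_all add: lift_def)

lemma inst_simps [simp]:
  "inst t Bot = Bot"
  "inst t (Imp A B) = Imp (inst t A) (inst t B)"
  by (simp_all add: inst_def)

section \<open>Natural deduction\<close>

text \<open>\<open>ImpI\<close> discharges only well-formed assumptions, so arguments by double
  negation need well-formedness of the formulas in the premises of a rule.\<close>

lemma derives_wf:
  "derives S L G D A \<Longrightarrow> \<forall>B\<in>G. wf_fm S B \<Longrightarrow> \<forall>B\<in>D. wf_fm S B \<Longrightarrow> wf_fm S A"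
  by (induction rule: derives.induct) (auto simp: wf_lift wf_inst dest: wf_fm_if_wf_inst)

lemma weaken: "derives S L G D A \<Longrightarrow> D \<subseteq> D' \<Longrightarrow> derives S L G D' A"
proof (induction arbitrary: D' rule: derives.induct)
  case (OrE D A B C)
  show ?case
    by (rule derives.OrE[OF OrE.IH(1)[OF OrE.prems] OrE.IH(2) OrE.IH(3)]) (use OrE.prems in auto)
next
  case (ImpI A D B)
  show ?case
    by (rule derives.ImpI[OF ImpI.hyps(1) ImpI.IH]) (use ImpI.prems in auto)
next
  case (AllI D A)
  show ?case
    by (rule derives.AllI[OF AllI.IH]) (use AllI.prems in auto)
next
  case (ExE D A C)
  show ?case
    by (rule derives.ExE[OF ExE.IH(1)[OF ExE.prems] ExE.IH(2)]) (use ExE.prems in auto)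
qed (blast intro: derives.intros)+

lemma weaken_insert: "derives S L G D A \<Longrightarrow> derives S L G (insert B D) A"
  by (erule weaken) auto

lemma cut: "derives S L G D A \<Longrightarrow> derives S L G (insert A D) B \<Longrightarrow> wf_fm S A \<Longrightarrow> derives S L G D B"
  by (blast intro: derives.ImpI derives.ImpE)

lemma hyp: "derives S L G (insert A D) A"
  by (simp add: derives.Assm)

lemma hyp2: "derives S L G (insert B (insert A D)) A"
  by (simp add: derives.Assm)

section \<open>Double negation as a monad in minimal logic\<close>

lemma dn_intro: "derives S L G D A \<Longrightarrow> wf_fm S A \<Longrightarrow> derives S L G D (Neg (Neg A))"
  by (rule derives.ImpI) (auto intro: derives.ImpE[OF hyp] weaken_insert)

lemma dn_elim_Bot:
  "derives S L G D (Neg (Neg A)) \<Longrightarrow> derives S L G (insert A D) Bot \<Longrightarrow> wf_fm S A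
    \<Longrightarrow> derives S L G D Bot"
  by (blast intro: derives.ImpI derives.ImpE)

text \<open>The bind of the monad: once \<open>Neg B\<close> is assumed the goal is
  \<open>Bot\<close>, and towards \<open>Bot\<close> a doubly negated \<open>A\<close> may be used
  as if it were \<open>A\<close>.\<close>

lemma dn_bind:
  assumes "derives S L G D (Neg (Neg A))" "derives S L G (insert A D) (Neg (Neg B))"
    and "wf_fm S A" "wf_fm S B"
  shows "derives S L G D (Neg (Neg B))"
proof (rule derives.ImpI)
  show "derives S L G (insert (Neg B) D) Bot"
  proof (rule dn_elim_Bot)
    show "derives S L G (insert (Neg B) D) (Neg (Neg A))"
      using assms(1) by (rule weaken_insert)
    have "derives S L G (insert A (insert (Neg B) D)) (Neg (Neg B))"
      using assms(2) by (rule weaken) auto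
    then show "derives S L G (insert A (insert (Neg B) D)) Bot"
      by (rule derives.ImpE) (auto intro: derives.Assm)
  qed fact
qed (use assms in simp)

text \<open>Bridges two forms of assumption: induction hypotheses carry \<open>K_trans i A\<close>
  in the context, whereas the rules applied after a bind supply the stronger
  \<open>K_sub i A\<close>.\<close>

lemma assm_dn:
  assumes "derives S L G (insert (Neg (Neg A)) D) B" "wf_fm S A"
  shows "derives S L G (insert A D) B"
proof (rule cut)
  show "derives S L G (insert A D) (Neg (Neg A))"
    by (rule dn_intro[OF hyp]) fact
  show "derives S L G (insert (Neg (Neg A)) (insert A D)) B"
    using assms(1) by (rule weaken) auto
qed (use assms in simp)

text \<open>The implication is required in every context because it is applied below the quantifier,
  in the lifted one.\<close>

lemma All_mono:
  assumes "\<And>D. derives S L G D (Imp A B)" "wf_fm S A"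
  shows "derives S L G D (Imp (All A) (All B))"
proof (intro derives.ImpI derives.AllI)
  let ?D = "lift ` insert (All A) D"
  have "derives S L G ?D (lift (All A))"
    by (rule derives.Assm) blast
  then have "derives S L G ?D (inst (Var 0) (subst_fm (under (\<lambda>n. Var (Suc n))) A))"
    unfolding lift_simps by (rule derives.AllE) simp
  then show "derives S L G ?D B"
    unfolding inst_lift_body using assms(1) by (blast intro: derives.ImpE)
qed (use assms in simp)

lemma Ex_mono:
  assumes "\<And>D. derives S L G D (Imp A B)" "wf_fm S A"
  shows "derives S L G D (Imp (Ex A) (Ex B))"
proof (intro derives.ImpI derives.ExE[OF hyp])
  let ?D = "insert A (lift ` insert (Ex A) D)"
  have "derives S L G ?D (inst (Var 0) (subst_fm (under (\<lambda>n. Var (Suc n))) B))"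
    unfolding inst_lift_body using assms(1) hyp by (rule derives.ImpE)
  then show "derives S L G ?D (lift (Ex B))"
    unfolding lift_simps by (rule derives.ExI) simp
qed (use assms in simp)

section \<open>The translations\<close>

lemma wf_K_atom: "wf_fm S (K_atom i A) \<longleftrightarrow> wf_fm S A"
  by (auto simp: K_atom_def)

lemma wf_K_imp: "wf_fm S (K_imp i A B) \<longleftrightarrow> wf_fm S A \<and> wf_fm S B"
  by (auto simp: K_imp_def)

lemma wf_K_sub: "wf_fm S (K_sub i A) \<longleftrightarrow> wf_fm S A"
  by (induction A) (auto simp: wf_K_atom wf_K_imp)

text \<open>The clauses only add propositional connectives and introduce no new binders, so
  substitution passes through them. The quantifier rules depend on this.\<close>

lemma K_sub_subst: "K_sub i (subst_fm s A) = subst_fm s (K_sub i A)"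
  by (induction A arbitrary: s) (auto simp: K_atom_def K_imp_def)

lemma K_trans_lift: "K_trans i (lift A) = lift (K_trans i A)"
  by (simp add: K_trans_def lift_def K_sub_subst)

text \<open>After assuming \<open>Neg B\<close> the goal is \<open>Bot\<close>, and each clause
  refutes \<open>A\<close> together with \<open>Neg B\<close>. The extra disjunct \<open>Bot\<close>
  of variant 4 then closes the goal itself, so no ex falso is involved.\<close>

lemma K_imp_elim:
  assumes "derives S L G D (Neg (Neg (K_imp i A B)))" "derives S L G D A"
    and wf: "wf_fm S A" "wf_fm S B"
  shows "derives S L G D (Neg (Neg B))"
proof (rule dn_bind[OF assms(1)])
  let ?D = "insert (Neg B) (insert (K_imp i A B) D)"
  have K: "derives S L G ?D (K_imp i A B)" and N: "derives S L G ?D (Neg B)"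
    by (auto intro: derives.Assm)
  have A: "derives S L G ?D A"
    using assms(2) by (rule weaken) auto
  have Neg_B: "derives S L G (insert B ?D) Bot"
    by (rule derives.ImpE[of _ _ _ _ B]) (auto intro: derives.Assm)
  consider "i = 4" | "i = 5" | "i = 6" | "i = 7" | "i = 8" | "i \<notin> {4, 5, 6, 7, 8}"
    by blast
  then have "derives S L G ?D Bot"
  proof cases
    case 1
    then have "derives S L G ?D (Or B Bot)"
      using derives.ImpE[OF _ A] K by (simp add: K_imp_def)
    then show ?thesis
      by (rule derives.OrE[OF _ Neg_B hyp])
  next
    case 2
    then have "derives S L G ?D (Or (Neg A) B)"
      using K by (simp add: K_imp_def)
    then show ?thesis
      by (rule derives.OrE[OF _ derives.ImpE[OF hyp weaken_insert[OF A]] Neg_B])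
  next
    case 3
    then have "derives S L G ?D (Neg (Neg B))"
      using derives.ImpE[OF _ A] K by (simp add: K_imp_def)
    then show ?thesis
      using N by (rule derives.ImpE)
  next
    case 4
    then have "derives S L G ?D (Neg A)"
      using derives.ImpE[OF _ N] K by (simp add: K_imp_def)
    then show ?thesis
      using A by (rule derives.ImpE)
  next
    case 5
    then have "derives S L G ?D (Neg (And A (Neg B)))"
      using K by (simp add: K_imp_def)
    then show ?thesis
      using derives.AndI[OF A N] by (rule derives.ImpE)
  next
    case 6
    then have "derives S L G ?D B"
      using derives.ImpE[OF _ A] K by (simp add: K_imp_def)
    then show ?thesis
      by (rule derives.ImpE[OF N])
  qed
  then show "derives S L G (insert (K_imp i A B) D) (Neg (Neg B))"
    using wf by (auto intro: derives.ImpI)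
qed (use wf in \<open>simp_all add: wf_K_imp\<close>)

text \<open>Variants 6, 7 and 8 follow outright from \<open>A\<close> implying
  \<open>Neg (Neg B)\<close>. The other clauses are reached through \<open>dn_if_refuting\<close>:
  each must follow both from \<open>B\<close> and from \<open>Neg A\<close>. In variants 4 and 5 a
  disjunct absorbs the refutation of \<open>A\<close>; the default clause has none, whence the
  hypothesis on \<open>Bot\<close>.\<close>

lemma K_imp_intro:
  assumes B: "derives S L G (insert A D) (Neg (Neg B))"
    and wf: "wf_fm S A" "wf_fm S B"
    and efq: "i \<notin> {4, 5, 6, 7, 8} \<Longrightarrow> derives S L G D (Imp Bot B)"
  shows "derives S L G D (Neg (Neg (K_imp i A B)))"
proof -
  have dni: "derives S L G D (Neg (Neg (K_imp i A B)))" if "derives S L G D (K_imp i A B)"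
    using that wf by (simp add: dn_intro wf_K_imp)
  \<comment> \<open>If \<open>B\<close> implies \<open>C\<close>, then \<open>\<not>C\<close> yields \<open>\<not>B\<close> and hence \<open>\<not>A\<close>.\<close>
  have dn_if_refuting: "derives S L G D (Neg (Neg C))"
    if C: "C = K_imp i A B" and BC: "\<And>D. derives S L G (insert B D) C"
      and NC: "\<And>E. D \<subseteq> E \<Longrightarrow> derives S L G E (Neg A) \<Longrightarrow> derives S L G E C" for C
  proof (rule derives.ImpI)
    let ?D = "insert (Neg C) D"
    have wfC: "wf_fm S C"
      using wf C by (simp add: wf_K_imp)
    then show "wf_fm S (Neg C)"
      by simp
    have "derives S L G (insert B (insert A ?D)) Bot"
      by (rule derives.ImpE[OF _ BC]) (auto intro: derives.Assm)
    then have "derives S L G (insert A ?D) (Neg B)"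
      using wf by (auto intro: derives.ImpI)
    moreover have "derives S L G (insert A ?D) (Neg (Neg B))"
      using B by (rule weaken) auto
    ultimately have "derives S L G ?D (Neg A)"
      using wf by (blast intro: derives.ImpI derives.ImpE)
    then have "derives S L G ?D C"
      by (intro NC) auto
    then show "derives S L G ?D Bot"
      by (rule derives.ImpE[OF hyp])
  qed
  consider "i = 4" | "i = 5" | "i = 6" | "i = 7" | "i = 8" | "i \<notin> {4, 5, 6, 7, 8}"
    by blast
  then show ?thesis
  proof cases
    case 1
    then have K: "K_imp i A B = Imp A (Or B Bot)"
      by (simp add: K_imp_def)
    show ?thesis
      unfolding K
    proof (rule dn_if_refuting)
      fix E
      assume "derives S L G E (Neg A)"
      then have "derives S L G (insert A E) Bot"
        by (rule derives.ImpE[OF weaken_insert hyp])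
      then show "derives S L G E (Imp A (Or B Bot))"
        using wf by (auto intro: derives.ImpI derives.OrI2)
    qed (use K wf in \<open>auto intro!: derives.ImpI derives.OrI1 hyp2\<close>)
  next
    case 2
    then have K: "K_imp i A B = Or (Neg A) B"
      by (simp add: K_imp_def)
    show ?thesis
      unfolding K
      by (rule dn_if_refuting)
        (use K wf in \<open>auto intro: derives.OrI1 intro!: derives.OrI2[OF hyp]\<close>)
  next
    case 3
    then have K: "K_imp i A B = Imp A (Neg (Neg B))"
      by (simp add: K_imp_def)
    show ?thesis
      by (rule dni) (use B wf in \<open>simp add: K derives.ImpI\<close>)
  next
    case 4
    then have K: "K_imp i A B = Imp (Neg B) (Neg A)"
      by (simp add: K_imp_def)
    have "derives S L G (insert A (insert (Neg B) D)) (Neg (Neg B))"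
      using B by (rule weaken) auto
    then have "derives S L G (insert A (insert (Neg B) D)) Bot"
      by (rule derives.ImpE) (auto intro: derives.Assm)
    then show ?thesis
      by (intro dni) (use wf in \<open>simp add: K derives.ImpI\<close>)
  next
    case 5
    then have K: "K_imp i A B = Neg (And A (Neg B))"
      by (simp add: K_imp_def)
    let ?D = "insert (And A (Neg B)) D"
    have "derives S L G D (Imp A (Neg (Neg B)))"
      using B wf by (simp add: derives.ImpI)
    then have "derives S L G ?D (Neg (Neg B))"
      by (rule derives.ImpE[OF weaken_insert derives.AndE1[OF hyp]])
    then have "derives S L G ?D Bot"
      by (rule derives.ImpE[OF _ derives.AndE2[OF hyp]])
    then show ?thesis
      by (intro dni) (use wf in \<open>simp add: K derives.ImpI\<close>)
  next
    case 6
    then have K: "K_imp i A B = Imp A B"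
      by (simp add: K_imp_def)
    show ?thesis
      unfolding K
    proof (rule dn_if_refuting)
      fix E
      assume E: "D \<subseteq> E" and "derives S L G E (Neg A)"
      then have "derives S L G (insert A E) Bot"
        by (intro derives.ImpE[OF weaken_insert hyp])
      \<comment> \<open>Ex falso for \<open>B\<close> enters here: \<open>A\<close> and
        \<open>Neg A\<close> yield only \<open>Bot\<close>, which still has to yield
        \<open>B\<close>.\<close>
      moreover have "derives S L G (insert A E) (Imp Bot B)"
        using efq[OF 6] E by (auto intro: weaken)
      ultimately show "derives S L G E (Imp A B)"
        using wf by (blast intro: derives.ImpI derives.ImpE)
    qed (use K wf in \<open>auto intro!: derives.ImpI hyp2\<close>)
  qed
qed

text \<open>\<open>Bot\<close> is itself an atom and gets modified too. Variants 2 and 3 both turn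
  it into \<open>Imp (Imp Bot Bot) Bot\<close>, to be applied to the identity; in variant 1 both
  disjuncts are \<open>Bot\<close>.\<close>

lemma K_atom_Bot_elim: "derives S L G (insert (K_atom i Bot) D) Bot"
proof -
  consider "i = 1" | "i = 2" | "i = 3" | "i \<notin> {1, 2, 3}"
    by blast
  then show ?thesis
  proof cases
    case 1
    then show ?thesis
      by (auto simp: K_atom_def intro: derives.OrE[OF hyp hyp hyp])
  next
    case 2
    then show ?thesis
      by (auto simp: K_atom_def intro!: derives.ImpE[OF hyp] derives.ImpI hyp)
  next
    case 3
    then show ?thesis
      by (auto simp: K_atom_def intro!: derives.ImpE[OF hyp] derives.ImpI hyp)
  qed (simp add: K_atom_def hyp)
qed

text \<open>Each modified atom follows from \<open>Bot\<close> in minimal logic, and the property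
  propagates through the connectives.\<close>

lemma K_sub_efq:
  assumes "i \<in> {1, 2, 3}"
  shows "wf_fm S A \<Longrightarrow> Bot \<in> D \<Longrightarrow> derives S L G D (K_sub i A)"
proof (induction A arbitrary: D)
  case (Pred p ts)
  then show ?case
    using assms
    by (auto simp: K_atom_def
        intro!: derives.ImpI derives.OrI2 intro: derives.Assm derives.ImpE[OF hyp])
next
  case (And A B)
  then show ?case
    by (auto intro: derives.AndI)
next
  case (Or A B)
  then show ?case
    by (auto intro: derives.OrI1 simp: wf_K_sub)
next
  case (Imp A B)
  have "K_sub i (Imp A B) = Imp (K_sub i A) (K_sub i B)"
    using assms by (auto simp: K_imp_def)
  moreover have "derives S L G (insert (K_sub i A) D) (K_sub i B)"
    by (rule Imp.IH(2)) (use Imp.prems in auto)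
  ultimately show ?case
    using Imp.prems by (simp add: derives.ImpI wf_K_sub)
next
  case (All A)
  \<comment> \<open>\<open>Bot\<close> has no variables, so it survives the lifting of the
    context.\<close>
  have "Bot \<in> lift ` D"
    using All.prems by (auto intro!: image_eqI[of _ _ Bot])
  then have "derives S L G (insert B (lift ` D)) Bot" for B
    by (simp add: derives.Assm)
  with All.prems show ?case
    by (auto simp: wf_K_sub intro!: derives.AllI derives.ImpI)
next
  case (Ex A)
  \<comment> \<open>The induction hypothesis gives the body, not an instance. Generalising it and
    instantiating with a variable provides a witness, even over a signature without
    constants.\<close>
  have "derives S L G (lift ` D) (K_sub i A)"
    using Ex.prems by (intro Ex.IH) (auto intro!: image_eqI[of _ _ Bot])
  then have "derives S L G D (inst (Var 0) (K_sub i A))"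
    by (intro derives.AllE derives.AllI) auto
  then show ?case
    by (auto intro: derives.ExI)
qed (use assms in \<open>auto simp: K_atom_def
        intro!: derives.ImpI derives.OrI2 intro: derives.Assm derives.ImpE[OF hyp]\<close>)

section \<open>Soundness\<close>

text \<open>Open assumptions are translated like the axioms, so the induction covers rules that
  change the context. The target logic is left arbitrary: the construction uses only rules available
  in both logics.\<close>

lemma K_sound:
  assumes "derives S Classical G D A"
    and i: "i \<in> {1, 2, 3, 4, 5, 6, 7, 8}"
    and G: "\<forall>B\<in>G. wf_fm S B"
    and "\<forall>B\<in>D. wf_fm S B"
  shows "derives S L (K_trans i ` G) (K_trans i ` D) (K_trans i A)"
  using assms(1,4)
proof (induction rule: derives.induct)
  case (Axiom A D)
  then show ?case
    by (blast intro: derives.Axiom)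
next
  case (Assm A D)
  then show ?case
    by (blast intro: derives.Assm)
next
  case (AndI D A B)
  then have wf: "wf_fm S A" "wf_fm S B"
    using derives_wf G by blast+
  show ?case
    unfolding K_trans_def
    by (rule dn_bind[OF AndI.IH(1)[OF AndI.prems, unfolded K_trans_def]],
        rule dn_bind[OF weaken_insert[OF AndI.IH(2)[OF AndI.prems, unfolded K_trans_def]]])
      (use wf in \<open>auto simp: wf_K_sub intro!: dn_intro derives.AndI hyp hyp2\<close>)
next
  case (AndE1 D A B)
  then have wf: "wf_fm S A" "wf_fm S B"
    using derives_wf[OF AndE1.hyps(1) G] by auto
  show ?case
    unfolding K_trans_def
    by (rule dn_bind[OF AndE1.IH[OF AndE1.prems, unfolded K_trans_def]])
      (use wf in \<open>auto simp: wf_K_sub intro!: dn_intro derives.AndE1[OF hyp]\<close>)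
next
  case (AndE2 D A B)
  then have wf: "wf_fm S A" "wf_fm S B"
    using derives_wf[OF AndE2.hyps(1) G] by auto
  show ?case
    unfolding K_trans_def
    by (rule dn_bind[OF AndE2.IH[OF AndE2.prems, unfolded K_trans_def]])
      (use wf in \<open>auto simp: wf_K_sub intro!: dn_intro derives.AndE2[OF hyp]\<close>)
next
  case (OrI1 D A B)
  then have wf: "wf_fm S A" "wf_fm S B"
    using derives_wf G by blast+
  show ?case
    unfolding K_trans_def
    by (rule dn_bind[OF OrI1.IH[OF OrI1.prems, unfolded K_trans_def]])
      (use wf in \<open>auto simp: wf_K_sub intro!: dn_intro derives.OrI1[OF hyp]\<close>)
next
  case (OrI2 D B A)
  then have wf: "wf_fm S A" "wf_fm S B"
    using derives_wf G by blast+
  show ?case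
    unfolding K_trans_def
    by (rule dn_bind[OF OrI2.IH[OF OrI2.prems, unfolded K_trans_def]])
      (use wf in \<open>auto simp: wf_K_sub intro!: dn_intro derives.OrI2[OF hyp]\<close>)
next
  case (OrE D A B C)
  then have wf: "wf_fm S A" "wf_fm S B"
    using derives_wf[OF OrE.hyps(1) G] by auto
  then have wfC: "wf_fm S C"
    using derives_wf[OF OrE.hyps(2) G] OrE.prems by auto
  let ?D = "K_trans i ` D"
  \<comment> \<open>\<open>E\<close> stands for the disjunction, which remains in the context when
    it is eliminated as a hypothesis.\<close>
  have case_assm: "derives S L (K_trans i ` G) (insert (K_sub i X) (insert E ?D)) (K_trans i C)"
    if "derives S L (K_trans i ` G) (K_trans i ` insert X D) (K_trans i C)" "wf_fm S X" for X E
  proof (rule weaken)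
    show "derives S L (K_trans i ` G) (insert (K_sub i X) ?D) (K_trans i C)"
      by (rule assm_dn) (use that in \<open>auto simp: K_trans_def wf_K_sub\<close>)
  qed auto
  have "derives S L (K_trans i ` G) (insert (K_sub i (Or A B)) ?D) (K_trans i C)"
    unfolding K_sub.simps
    by (rule derives.OrE[OF hyp]; rule case_assm) (use OrE wf in auto)
  then show ?case
    unfolding K_trans_def
    by (intro dn_bind[OF OrE.IH(1)[OF OrE.prems, unfolded K_trans_def]])
      (use wf wfC in \<open>auto simp: wf_K_sub\<close>)
next
  case (ImpI A D B)
  then have wf: "wf_fm S A" "wf_fm S B"
    using derives_wf[OF ImpI.hyps(2) G] by auto
  let ?D = "K_trans i ` D"
  have "derives S L (K_trans i ` G) (insert (K_sub i A) ?D) (K_trans i B)"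
    by (rule assm_dn) (use ImpI wf in \<open>auto simp: K_trans_def wf_K_sub\<close>)
  \<comment> \<open>Outside variants 4 to 8 only 1, 2 and 3 remain, and their atoms supply ex
    falso.\<close>
  moreover have "derives S L (K_trans i ` G) ?D (Imp Bot (K_sub i B))" if "i \<notin> {4, 5, 6, 7, 8}"
    by (intro derives.ImpI K_sub_efq) (use that i wf in auto)
  ultimately show ?case
    unfolding K_trans_def K_sub.simps
    by (intro K_imp_intro) (use wf in \<open>auto simp: wf_K_sub\<close>)
next
  case (ImpE D A B)
  then have wf: "wf_fm S A" "wf_fm S B"
    using derives_wf[OF ImpE.hyps(1) G] by auto
  show ?case
    unfolding K_trans_def
  \<comment> \<open>Only the minor premise is bound; \<open>K_imp_elim\<close> takes the major
    premise doubly negated.\<close>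
  proof (rule dn_bind[OF ImpE.IH(2)[OF ImpE.prems, unfolded K_trans_def]], rule K_imp_elim[OF _ hyp])
    show "derives S L ((\<lambda>A. Neg (Neg (K_sub i A))) ` G)
        (insert (K_sub i A) ((\<lambda>A. Neg (Neg (K_sub i A))) ` D))
        (Neg (Neg (K_imp i (K_sub i A) (K_sub i B))))"
      using weaken_insert[OF ImpE.IH(1)[OF ImpE.prems]] by (simp add: K_trans_def)
  qed (use wf in \<open>auto simp: wf_K_sub\<close>)
next
  case (AllI D A)
  have "\<forall>B\<in>lift ` D. wf_fm S B"
    using AllI.prems by (auto simp: wf_lift)
  moreover from this have wf: "wf_fm S A"
    using derives_wf[OF AllI.hyps G] by blast
  ultimately have "derives S L (K_trans i ` G) (lift ` K_trans i ` D) (K_trans i A)"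
    using AllI.IH by (simp add: image_image K_trans_lift)
  \<comment> \<open>The body of the translated quantifier is \<open>K_trans i A\<close> itself, so
    generalisation applies directly and no double negation shift arises.\<close>
  then show ?case
    using wf by (simp add: K_trans_def[of i "All A"])
      (auto simp: K_trans_def[of i A] wf_K_sub intro: dn_intro derives.AllI)
next
  case (AllE D A t)
  then have wf: "wf_fm S A"
    using derives_wf[OF AllE.hyps(1) G] by auto
  have K: "K_sub i (inst t A) = inst t (K_sub i A)"
    by (simp add: inst_def K_sub_subst)
  let ?D = "insert (All (Neg (Neg (K_sub i A)))) (K_trans i ` D)"
  have "derives S L (K_trans i ` G) ?D (inst t (Neg (Neg (K_sub i A))))"
    by (rule derives.AllE[OF hyp]) fact
  then show ?case
    unfolding K_trans_def K
    by (intro dn_bind[OF AllE.IH[OF AllE.prems, unfolded K_trans_def]])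
      (use wf AllE.hyps in \<open>auto simp: wf_K_sub K_trans_def wf_inst\<close>)
next
  case (ExI D t A)
  have "wf_fm S (inst t A)"
    using derives_wf[OF ExI.hyps(1) G ExI.prems] .
  then have wf: "wf_fm S A" "wf_fm S (inst t A)"
    by (auto dest: wf_fm_if_wf_inst)
  have K: "K_sub i (inst t A) = inst t (K_sub i A)"
    by (simp add: inst_def K_sub_subst)
  show ?case
    unfolding K_trans_def
    by (rule dn_bind[OF ExI.IH[OF ExI.prems, unfolded K_trans_def]])
      (use wf ExI.hyps in \<open>auto simp: wf_K_sub wf_inst K intro!: dn_intro derives.ExI[OF hyp]\<close>)
next
  case (ExE D A C)
  then have wf: "wf_fm S A"
    using derives_wf[OF ExE.hyps(1) G] by auto
  then have wf': "\<forall>B\<in>insert A (lift ` D). wf_fm S B"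
    using ExE.prems by (auto simp: wf_lift)
  then have wfC: "wf_fm S C"
    using derives_wf[OF ExE.hyps(2) G] by (auto simp: wf_lift)
  let ?D = "K_trans i ` D"
  have "derives S L (K_trans i ` G) (insert (K_sub i A) (lift ` ?D)) (lift (K_trans i C))"
    by (rule assm_dn)
      (use ExE.IH(2)[OF wf'] wf in
        \<open>auto simp: K_trans_lift image_image K_trans_def[of i A] wf_K_sub\<close>)
  then have "derives S L (K_trans i ` G)
      (insert (K_sub i A) (lift ` insert (Ex (K_sub i A)) ?D)) (lift (K_trans i C))"
    by (rule weaken) auto
  then have "derives S L (K_trans i ` G) (insert (K_sub i (Ex A)) ?D) (K_trans i C)"
    unfolding K_sub.simps by (rule derives.ExE[OF hyp])
  then show ?case
    unfolding K_trans_def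
    by (intro dn_bind[OF ExE.IH(1)[OF ExE.prems, unfolded K_trans_def]])
      (use wf wfC in \<open>auto simp: wf_K_sub\<close>)
next
  case (DNE D A)
  then have wf: "wf_fm S A"
    using derives_wf[OF DNE.hyps(2) G] by auto
  \<comment> \<open>\<open>?F\<close> is \<open>K_sub i Bot\<close>, hence
    \<open>K_imp i ?A ?F\<close> translates \<open>Neg A\<close>. From \<open>Neg ?A\<close> it is
    obtained up to double negation; played against the translated premise it gives
    \<open>Neg (Neg ?F)\<close>, and so \<open>Bot\<close>.\<close>
  let ?A = "K_sub i A" and ?F = "K_atom i Bot" and ?G = "K_trans i ` G"
  let ?D = "insert (Neg ?A) (K_trans i ` D)"
  have wfs: "wf_fm S ?A" "wf_fm S ?F" "wf_fm S (K_imp i ?A ?F)"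
    using wf by (auto simp: wf_K_sub wf_K_atom wf_K_imp)
  have "derives S L ?G (insert ?A ?D) Bot"
    by (rule derives.ImpE[of _ _ _ _ ?A]) (auto intro: derives.Assm)
  then have "derives S L ?G (insert ?A ?D) (Neg (Neg ?F))"
    using wfs by (auto intro!: derives.ImpI intro: weaken_insert)
  then have not_not_neg: "derives S L ?G ?D (Neg (Neg (K_imp i ?A ?F)))"
  proof (rule K_imp_intro)
    assume "i \<notin> {4, 5, 6, 7, 8}"
    then show "derives S L ?G ?D (Imp Bot ?F)"
      using i K_sub_efq[of i S Bot] by (auto intro: derives.ImpI)
  qed (use wfs in auto)
  have "derives S L ?G (insert (K_imp i ?A ?F) ?D) (Neg (Neg ?F))"
  proof (rule K_imp_elim[OF _ hyp])
    show "derives S L ?G (insert (K_imp i ?A ?F) ?D)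
        (Neg (Neg (K_imp i (K_imp i ?A ?F) ?F)))"
      by (rule weaken[OF DNE.IH[OF DNE.prems, unfolded K_trans_def K_sub.simps],
            folded K_trans_def]) auto
  qed (use wfs in auto)
  then have "derives S L ?G (insert (K_imp i ?A ?F) ?D) Bot"
    using K_atom_Bot_elim wfs(2) by (rule dn_elim_Bot)
  with not_not_neg have "derives S L ?G ?D Bot"
    using wfs(3) by (rule dn_elim_Bot)
  then show ?case
    using wfs by (auto simp: K_trans_def[of i A] intro: derives.ImpI)
qed

section \<open>Characterisation\<close>

lemma classical_dne: "derives S Classical G D (Neg (Neg A)) \<Longrightarrow> derives S Classical G D A"
  by (rule derives.DNE) simp

lemma classical_efq: "derives S Classical G D Bot \<Longrightarrow> wf_fm S A \<Longrightarrow> derives S Classical G D A"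
  by (rule classical_dne) (auto intro!: derives.ImpI weaken_insert)

lemma classical_Imp_K_atom:
  assumes "wf_fm S P"
  shows "derives S Classical G D (Imp P (K_atom i P))"
  using assms
  by (auto simp: K_atom_def intro!: derives.ImpI derives.OrI1[OF hyp] dn_intro[OF hyp]
      intro: derives.Assm)

lemma classical_K_atom_Imp:
  assumes "wf_fm S P"
  shows "derives S Classical G D (Imp (K_atom i P) P)"
proof (rule derives.ImpI)
  have "derives S Classical G (insert (Imp (Imp Bot P) P) D) P"
    by (rule derives.ImpE[OF hyp])
      (use assms in \<open>auto intro!: derives.ImpI intro: classical_efq[OF hyp]\<close>)
  moreover have "derives S Classical G (insert (Or P Bot) D) P"
    using assms by (intro derives.OrE[OF hyp hyp classical_efq[OF hyp]])
  moreover have "derives S Classical G (insert (Neg (Neg P)) D) P"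
    by (rule classical_dne[OF hyp])
  ultimately show "derives S Classical G (insert (K_atom i P) D) P"
    by (simp add: K_atom_def hyp)
qed (use assms in \<open>simp add: wf_K_atom\<close>)

text \<open>Both directions go through one induction because implication is contravariant in its
  first argument.\<close>

lemma classical_K_sub_iff:
  assumes "wf_fm S A"
  shows "derives S Classical G D (Imp A (K_sub i A)) \<and> derives S Classical G D (Imp (K_sub i A) A)"
  using assms
proof (induction A arbitrary: D)
  case (And A B)
  \<comment> \<open>Stated for arbitrary formulas so that exchanging the primed and unprimed ones
    gives the converse.\<close>
  have "derives S Classical G D (Imp (And A B) (And A' B'))"
    if "\<And>D. derives S Classical G D (Imp A A')" "\<And>D. derives S Classical G D (Imp B B')"
      and "wf_fm S (And A B)" for A B A' B'
    using that
    by (auto intro!: derives.ImpI derives.AndI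
        intro: derives.ImpE[OF _ derives.AndE1[OF hyp]] derives.ImpE[OF _ derives.AndE2[OF hyp]])
  with And show ?case
    by (simp add: wf_K_sub)
next
  case (Or A B)
  have "derives S Classical G D (Imp (Or A B) (Or A' B'))"
    if "\<And>D. derives S Classical G D (Imp A A')" "\<And>D. derives S Classical G D (Imp B B')"
      and "wf_fm S (Or A B)" "wf_fm S (Or A' B')" for A B A' B'
    using that(3,4)
    by (auto intro!: derives.ImpI derives.OrE[OF hyp] derives.OrI1[OF derives.ImpE[OF that(1) hyp]]
        derives.OrI2[OF derives.ImpE[OF that(2) hyp]])
  with Or show ?case
    by (simp add: wf_K_sub)
next
  case (Imp A B)
  let ?A = "K_sub i A" and ?B = "K_sub i B"
  have wf: "wf_fm S A" "wf_fm S B" "wf_fm S ?A" "wf_fm S ?B"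
    using Imp.prems by (auto simp: wf_K_sub)
  have IH: "derives S Classical G D (Imp A ?A)" "derives S Classical G D (Imp ?A A)"
    "derives S Classical G D (Imp B ?B)" "derives S Classical G D (Imp ?B B)" for D
    using Imp wf by auto
  \<comment> \<open>\<open>K_imp_intro\<close> and \<open>K_imp_elim\<close> hold in every logic, so
    no new case distinction on \<open>i\<close> is needed: classical logic supplies ex falso and
    removes the double negations.\<close>
  have "derives S Classical G (insert ?A (insert (Imp A B) D)) B"
    by (rule derives.ImpE[OF derives.Assm derives.ImpE[OF IH(2) hyp]]) simp
  then have "derives S Classical G (insert ?A (insert (Imp A B) D)) (Neg (Neg ?B))"
    by (intro dn_intro derives.ImpE[OF IH(3)]) (use wf in auto)
  then have "derives S Classical G (insert (Imp A B) D) (Neg (Neg (K_imp i ?A ?B)))"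
    by (rule K_imp_intro)
      (use wf in \<open>auto intro!: derives.ImpI intro: classical_efq[OF hyp]\<close>)
  then have 1: "derives S Classical G D (Imp (Imp A B) (K_imp i ?A ?B))"
    using wf by (intro derives.ImpI) (auto intro: classical_dne)
  let ?D = "insert A (insert (K_imp i ?A ?B) D)"
  have "derives S Classical G ?D (Neg (Neg (K_imp i ?A ?B)))"
    using wf by (intro dn_intro derives.Assm) (auto simp: wf_K_imp)
  then have "derives S Classical G ?D ?B"
    by (rule classical_dne[OF K_imp_elim[OF _ derives.ImpE[OF IH(1) hyp] wf(3,4)]])
  then have "derives S Classical G ?D B"
    by (rule derives.ImpE[OF IH(4)])
  then have "derives S Classical G D (Imp (K_imp i ?A ?B) (Imp A B))"
    using wf by (auto intro!: derives.ImpI simp: wf_K_imp)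
  with 1 show ?case
    by simp
next
  case (All A)
  then have wf: "wf_fm S A" "wf_fm S (K_sub i A)"
    by (auto simp: wf_K_sub)
  have "derives S Classical G D (Imp A (Neg (Neg (K_sub i A))))" for D
    by (rule derives.ImpI[OF wf(1) dn_intro[OF derives.ImpE[OF _ hyp] wf(2)]])
      (use All.IH[OF wf(1)] in blast)
  moreover have "derives S Classical G D (Imp (Neg (Neg (K_sub i A))) A)" for D
    by (rule derives.ImpI[OF _ derives.ImpE[OF _ classical_dne[OF hyp]]])
      (use All.IH[OF wf(1)] wf in auto)
  ultimately show ?case
    using wf by (auto intro: All_mono)
next
  case (Ex A)
  then show ?case
    by (auto simp: wf_K_sub intro: Ex_mono)
qed (simp_all add: classical_Imp_K_atom classical_K_atom_Imp)

lemma classical_iff_K_trans: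
  assumes "wf_fm S A"
  shows "derives S Classical G D (Iff A (K_trans i A))"
proof -
  have wf: "wf_fm S (K_sub i A)"
    using assms by (simp add: wf_K_sub)
  note iff = classical_K_sub_iff[OF assms, of G _ i]
  show ?thesis
    unfolding K_trans_def
    using assms wf iff
    by (auto intro!: derives.AndI derives.ImpI dn_intro
        intro: derives.ImpE[OF _ hyp] derives.ImpE[OF _ classical_dne[OF hyp]])
qed

theorem mainTheorem1:
  fixes S :: "('f, 'p) signature"
    and i :: nat
    and G :: "('f, 'p) fm set"
    and A :: "('f, 'p) fm"
  assumes "i \<in> {1, 2, 3, 4, 5, 6, 7, 8}"
    and "\<forall>B\<in>G. wf_fm S B"
    and "wf_fm S A"
  shows "(provable S Classical G A \<longrightarrow> provable S Minimal (K_trans i ` G) (K_trans i A))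
    \<and> provable S Classical {} (Iff A (K_trans i A))"
  using K_sound[OF _ assms(1,2), of "{}"] classical_iff_K_trans[OF assms(3)]
  by (auto simp: provable_def)

end
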